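(* Let $r\ge 2$ and let $\mathcal{B}^F$ be the $TE$-structure of rank $r+1$ over a point defined in the context (the Fourier transform of the abstract Brieskorn lattice $\mathcal{B}=\sum_{j=0}^r\mathbb{C}\{\!\{\partial_t^{-1}\}\!\}\partial_t^{-j}e_j$ with $t\,\partial_t^{-k}e_j=(k+1)\partial_t^{-k-1}e_j$ for all $k\in\mathbb{Z}$ and $0\le j\le r$). Then there does not exist a versal deformation of $\mathcal{B}^F$ whose base space $(Z,0)$ has dimension $r+1$.
   Context: $TE$-structures. Let $(Z,0)$ be a germ of a complex manifold with local coordinates $z_1,\dots,z_n$, and let $z_0$ be the coordinate of $\mathbb{C}$. A (germ of a) $TE$-structure over $(Z,0)$ is a finite free $\mathcal{O}_{\mathbb{C}\times Z,0}$-module $M$ with actions of $z_0^2\partial_{z_0}$ and $z_0\partial_{z_i}$ $(1\le i\le n)$, i.e. with a flat meromorphic connection $\nabla$ on $M[z_0^{-1}]$ such that $z_0^2\nabla_{\partial_{z_0}}M\subset M$ and $z_0\nabla_{\partial_{z_i}}M\subset M$. Pull-backs $g^*M$ under morphisms of germs $g:(Z',0)\to(Z,0)$ are defined as pull-backs of modules with connection under $\mathrm{id}\times g$. The Fourier transform replaces $\partial_t^{-1}$ by $z_0$ and $t$ by $z_0^2\partial_{z_0}$. Thus $\mathcal{B}^F=\bigoplus_{j=0}^r\mathcal{O}_{\mathbb{C},0}\,f_j$ (with $f_j$ corresponding to $\partial_t^{-j}e_j$) with $$z_0^2\partial_{z_0}f_j=(j+1)\,z_0f_j\qquad(0\le j\le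 r).$$ Here $\mathbb{C}\{\!\{\partial_t^{-1}\}\!\}$ is the ring of series $\sum_{k\ge0}a_k\partial_t^{-k}$, $a_k\in\mathbb{C}$, with $\sum_ka_kx^k/k!$ convergent. A deformation of $\mathcal{B}^F$ over $(Z,0)$ is a $TE$-structure $M$ over $(Z,0)$ together with an isomorphism of its restriction to $\mathbb{C}\times\{0\}$ with $\mathcal{B}^F$. It is called versal if every deformation $M'$ of $\mathcal{B}^F$ over a germ of complex manifold $(Z',0)$ is isomorphic, as a deformation of $\mathcal{B}^F$, to $g^*M$ for some (not necessarily unique) morphism of germs $g:(Z',0)\to(Z,0)$. *)

theory Defs
  imports "HOL-Library.Multiset" "HOL-Analysis.Infinite_Sum"
begin

section \<open>Power series in the variables \<open>z\<^sub>0, z\<^sub>1, z\<^sub>2, \<dots>\<close>\<close>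

text \<open>
  A monomial \<open>z\<^sup>\<alpha>\<close> is encoded by the multiset \<open>\<alpha>\<close> of the indices of its variables: the exponent
  of \<open>z\<^sub>i\<close> is \<open>count \<alpha> i\<close>, the total degree is \<open>size \<alpha>\<close>, and the product of monomials is the sum
  of multisets.
\<close>

typedef mps = "UNIV :: (nat multiset \<Rightarrow> complex) set"
  morphisms mcoeff Abs_mps ..

setup_lifting type_definition_mps

lemma mps_eqI: "(\<And>\<alpha>. mcoeff f \<alpha> = mcoeff g \<alpha>) \<Longrightarrow> f = g"
  by transfer auto

lemma finite_submultisets [simp]: "finite {\<beta>. \<beta> \<subseteq># \<alpha>}"
proof (induction \<alpha>)
  case empty
  show ?case by simp
next
  case (add x \<alpha>)
  have "{\<beta>. \<beta> \<subseteq># add_mset x \<alpha>} \<subseteq> {\<beta>. \<beta> \<subseteq># \<alpha>} \<union> add_mset x ` {\<beta>. \<beta> \<subseteq># \<alpha>}"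
  proof
    fix \<beta> assume "\<beta> \<in> {\<beta>. \<beta> \<subseteq># add_mset x \<alpha>}"
    then have b: "\<beta> \<subseteq># add_mset x \<alpha>" by simp
    show "\<beta> \<in> {\<beta>. \<beta> \<subseteq># \<alpha>} \<union> add_mset x ` {\<beta>. \<beta> \<subseteq># \<alpha>}"
    proof (cases "x \<in># \<beta>")
      case True
      then obtain \<gamma> where "\<beta> = add_mset x \<gamma>" by (meson mset_add)
      with b show ?thesis by auto
    next
      case False
      with b have "\<beta> \<subseteq># \<alpha>"
        by (metis diff_single_trivial minus_add_mset_if_not_in_lhs subset_eq_diff_conv
            add_mset_add_single)
      then show ?thesis by simp
    qed
  qed
  with add show ?case by (meson finite_Un finite_imageI finite_subset)
qed

lemma msub:
  fixes \<alpha> \<beta> \<gamma> \<delta> :: "'a multiset"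
  shows "\<beta> \<subseteq># \<alpha> \<Longrightarrow> \<alpha> - (\<alpha> - \<beta>) = \<beta>"
    and "\<gamma> \<subseteq># \<beta> \<Longrightarrow> \<gamma> + (\<beta> - \<gamma>) = \<beta>"
    and "\<gamma> \<subseteq># \<beta> \<Longrightarrow> \<beta> \<subseteq># \<alpha> \<Longrightarrow> \<gamma> \<subseteq># \<alpha>"
    and "\<beta> \<subseteq># \<alpha> \<Longrightarrow> \<beta> - \<gamma> \<subseteq># \<alpha> - \<gamma>"
    and "\<gamma> \<subseteq># \<beta> \<Longrightarrow> \<beta> \<subseteq># \<alpha> \<Longrightarrow> \<alpha> - \<gamma> - (\<beta> - \<gamma>) = \<alpha> - \<beta>"
    and "\<gamma> \<subseteq># \<alpha> \<Longrightarrow> \<delta> \<subseteq># \<alpha> - \<gamma> \<Longrightarrow> \<gamma> + \<delta> \<subseteq># \<alpha>"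
proof -
  have *: "a + d \<le> b" if "a \<le> b" "d \<le> b - a" for a b d :: nat
    using that by linarith
  show "\<beta> \<subseteq># \<alpha> \<Longrightarrow> \<alpha> - (\<alpha> - \<beta>) = \<beta>" "\<gamma> \<subseteq># \<beta> \<Longrightarrow> \<gamma> + (\<beta> - \<gamma>) = \<beta>"
    "\<beta> \<subseteq># \<alpha> \<Longrightarrow> \<beta> - \<gamma> \<subseteq># \<alpha> - \<gamma>"
    "\<gamma> \<subseteq># \<beta> \<Longrightarrow> \<beta> \<subseteq># \<alpha> \<Longrightarrow> \<alpha> - \<gamma> - (\<beta> - \<gamma>) = \<alpha> - \<beta>"
    "\<gamma> \<subseteq># \<alpha> \<Longrightarrow> \<delta> \<subseteq># \<alpha> - \<gamma> \<Longrightarrow> \<gamma> + \<delta> \<subseteq># \<alpha>"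
    by (auto simp: multiset_eq_iff subseteq_mset_def diff_le_mono *)
  show "\<gamma> \<subseteq># \<beta> \<Longrightarrow> \<beta> \<subseteq># \<alpha> \<Longrightarrow> \<gamma> \<subseteq># \<alpha>"
    by (rule subset_mset.order_trans)
qed

instantiation mps :: comm_ring_1
begin

lift_definition zero_mps :: mps is "\<lambda>_. 0" .
lift_definition one_mps :: mps is "\<lambda>\<alpha>. if \<alpha> = {#} then 1 else 0" .
lift_definition plus_mps :: "mps \<Rightarrow> mps \<Rightarrow> mps" is "\<lambda>f g \<alpha>. f \<alpha> + g \<alpha>" .
lift_definition minus_mps :: "mps \<Rightarrow> mps \<Rightarrow> mps" is "\<lambda>f g \<alpha>. f \<alpha> - g \<alpha>" .
lift_definition uminus_mps :: "mps \<Rightarrow> mps" is "\<lambda>f \<alpha>. - f \<alpha>" .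
lift_definition times_mps :: "mps \<Rightarrow> mps \<Rightarrow> mps"
  is "\<lambda>f g \<alpha>. \<Sum>\<beta> | \<beta> \<subseteq># \<alpha>. f \<beta> * g (\<alpha> - \<beta>)" .

instance
proof
  fix a b c :: mps
  show "a * b * c = a * (b * c)"
  proof (transfer, rule ext)
    fix a b c :: "nat multiset \<Rightarrow> complex" and \<alpha> :: "nat multiset"
    have "(\<Sum>\<beta> | \<beta> \<subseteq># \<alpha>. (\<Sum>\<gamma> | \<gamma> \<subseteq># \<beta>. a \<gamma> * b (\<beta> - \<gamma>)) * c (\<alpha> - \<beta>))
        = (\<Sum>(\<beta>, \<gamma>) \<in> (SIGMA \<beta>:{\<beta>. \<beta> \<subseteq># \<alpha>}. {\<gamma>. \<gamma> \<subseteq># \<beta>}). a \<gamma> * b (\<beta> - \<gamma>) * c (\<alpha> - \<beta>))"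
      by (simp add: sum.Sigma sum_distrib_right)
    also have "\<dots> = (\<Sum>(\<gamma>, \<delta>) \<in> (SIGMA \<gamma>:{\<gamma>. \<gamma> \<subseteq># \<alpha>}. {\<delta>. \<delta> \<subseteq># \<alpha> - \<gamma>}).
                      a \<gamma> * (b \<delta> * c (\<alpha> - \<gamma> - \<delta>)))"
      by (rule sum.reindex_bij_witness[where i = "\<lambda>(\<gamma>, \<delta>). (\<gamma> + \<delta>, \<gamma>)"
                and j = "\<lambda>(\<beta>, \<gamma>). (\<gamma>, \<beta> - \<gamma>)"])
         (auto simp: mult.assoc msub)
    also have "\<dots> = (\<Sum>\<gamma> | \<gamma> \<subseteq># \<alpha>. a \<gamma> * (\<Sum>\<delta> | \<delta> \<subseteq># \<alpha> - \<gamma>. b \<delta> * c (\<alpha> - \<gamma> - \<delta>)))"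
      by (simp add: sum.Sigma sum_distrib_left)
    finally show "(\<Sum>\<beta> | \<beta> \<subseteq># \<alpha>. (\<Sum>\<gamma> | \<gamma> \<subseteq># \<beta>. a \<gamma> * b (\<beta> - \<gamma>)) * c (\<alpha> - \<beta>))
      = (\<Sum>\<gamma> | \<gamma> \<subseteq># \<alpha>. a \<gamma> * (\<Sum>\<delta> | \<delta> \<subseteq># \<alpha> - \<gamma>. b \<delta> * c (\<alpha> - \<gamma> - \<delta>)))" .
  qed
  show "a * b = b * a"
  proof (transfer, rule ext)
    fix a b :: "nat multiset \<Rightarrow> complex" and \<alpha> :: "nat multiset"
    show "(\<Sum>\<beta> | \<beta> \<subseteq># \<alpha>. a \<beta> * b (\<alpha> - \<beta>)) = (\<Sum>\<beta> | \<beta> \<subseteq># \<alpha>. b \<beta> * a (\<alpha> - \<beta>))"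
      by (rule sum.reindex_bij_witness[where i = "\<lambda>\<beta>. \<alpha> - \<beta>" and j = "\<lambda>\<beta>. \<alpha> - \<beta>"])
         (auto simp: msub mult.commute)
  qed
  show "1 * a = a"
  proof (transfer, rule ext)
    fix a :: "nat multiset \<Rightarrow> complex" and \<alpha> :: "nat multiset"
    have "(\<Sum>\<beta> | \<beta> \<subseteq># \<alpha>. (if \<beta> = {#} then 1 else 0) * a (\<alpha> - \<beta>))
        = (\<Sum>\<beta> | \<beta> \<subseteq># \<alpha>. if \<beta> = {#} then a \<alpha> else 0)"
      by (intro sum.cong) auto
    then show "(\<Sum>\<beta> | \<beta> \<subseteq># \<alpha>. (if \<beta> = {#} then 1 else 0) * a (\<alpha> - \<beta>)) = a \<alpha>"
      by simp
  qed
  show "(a + b) * c = a * c + b * c"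
    by transfer (simp add: distrib_right sum.distrib)
  show "(0::mps) \<noteq> 1"
    by transfer (metis one_neq_zero)
qed (transfer, simp add: add_ac)+

end

lift_definition mvar :: "nat \<Rightarrow> mps" is "\<lambda>i \<alpha>. if \<alpha> = {#i#} then 1 else 0" .

lift_definition pdiff :: "nat \<Rightarrow> mps \<Rightarrow> mps"
  is "\<lambda>i f \<alpha>. of_nat (count \<alpha> i + 1) * f (add_mset i \<alpha>)" .

text \<open>
  Substitution \<open>f(G\<^sub>0, \<dots>, G\<^sub>n)\<close> of power series without constant term into a power series
  \<open>f\<close> in \<open>z\<^sub>0, \<dots>, z\<^sub>n\<close>.  As \<open>\<Prod>\<^sub>i G\<^sub>i\<^sup>\<alpha>\<^sup>i\<close> has order at least \<open>size \<alpha>\<close>, only the finitely many \<open>\<alpha>\<close>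
  with \<open>size \<alpha> \<le> size \<gamma>\<close> contribute to the coefficient at \<open>\<gamma>\<close>.
\<close>

definition msubst :: "nat \<Rightarrow> (nat \<Rightarrow> mps) \<Rightarrow> mps \<Rightarrow> mps" where
  "msubst n G f = Abs_mps (\<lambda>\<gamma>.
     \<Sum>\<alpha> | set_mset \<alpha> \<subseteq> {..n} \<and> size \<alpha> \<le> size \<gamma>. mcoeff f \<alpha> * mcoeff (\<Prod>i\<in>#\<alpha>. G i) \<gamma>)"


section \<open>Germs of holomorphic functions\<close>

text \<open>
  A germ \<open>(Z, 0)\<close> of a complex manifold of dimension \<open>n\<close> is identified with \<open>(\<complex>\<^sup>n, 0)\<close> by its
  coordinates \<open>z\<^sub>1, \<dots>, z\<^sub>n\<close>.  The ring \<open>\<O>\<^bsub>\<complex>\<times>Z,0\<^esub>\<close> is the ring of power series in \<open>z\<^sub>0, \<dots>, z\<^sub>n\<close>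
  converging absolutely on some polydisc around \<open>0\<close>.
\<close>

definition germs :: "nat \<Rightarrow> mps set" where
  "germs n = {f. (\<forall>\<alpha>. mcoeff f \<alpha> \<noteq> 0 \<longrightarrow> set_mset \<alpha> \<subseteq> {..n}) \<and>
                 (\<exists>\<rho>>0. (\<lambda>\<alpha>. norm (mcoeff f \<alpha>) * \<rho> ^ size \<alpha>) summable_on UNIV)}"

text \<open>The subring \<open>\<O>\<^bsub>Z,0\<^esub>\<close> of germs not depending on \<open>z\<^sub>0\<close>.\<close>

definition base_germs :: "nat \<Rightarrow> mps set" where
  "base_germs n = {f \<in> germs n. \<forall>\<alpha>. mcoeff f \<alpha> \<noteq> 0 \<longrightarrow> 0 \<notin># \<alpha>}"

text \<open>
  A morphism of germs \<open>g : (\<complex>\<^sup>m, 0) \<rightarrow> (\<complex>\<^sup>n, 0)\<close> is given by its components \<open>g 1, \<dots>, g n\<close>.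
\<close>

definition germ_map :: "nat \<Rightarrow> nat \<Rightarrow> (nat \<Rightarrow> mps) \<Rightarrow> bool" where
  "germ_map m n g \<longleftrightarrow> (\<forall>i\<in>{1..n}. g i \<in> base_germs m \<and> mcoeff (g i) {#} = 0)"

text \<open>Pull-back of functions under \<open>id \<times> g\<close>.\<close>

definition germ_pull :: "nat \<Rightarrow> (nat \<Rightarrow> mps) \<Rightarrow> mps \<Rightarrow> mps" where
  "germ_pull n g = msubst n (g(0 := mvar 0))"


section \<open>\<open>TE\<close>-structures\<close>

text \<open>The free module \<open>\<O>\<^bsub>\<complex>\<times>Z,0\<^esub>\<^sup>k\<close> of rank \<open>k\<close> over \<open>germs n\<close>.\<close>

definition freemod :: "nat \<Rightarrow> nat \<Rightarrow> (nat \<Rightarrow> mps) set" where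
  "freemod n k = {v. (\<forall>a<k. v a \<in> germs n) \<and> (\<forall>a\<ge>k. v a = 0)}"

definition vadd :: "(nat \<Rightarrow> mps) \<Rightarrow> (nat \<Rightarrow> mps) \<Rightarrow> nat \<Rightarrow> mps" where
  "vadd u v = (\<lambda>a. u a + v a)"

definition smul :: "mps \<Rightarrow> (nat \<Rightarrow> mps) \<Rightarrow> nat \<Rightarrow> mps" where
  "smul f v = (\<lambda>a. f * v a)"

definition unitvec :: "nat \<Rightarrow> nat \<Rightarrow> mps" where
  "unitvec a = (\<lambda>b. if b = a then 1 else 0)"

text \<open>The derivations \<open>z\<^sub>0\<^sup>2\<partial>\<^sub>z\<^sub>0\<close> and \<open>z\<^sub>0\<partial>\<^sub>z\<^sub>i\<close> (\<open>i \<ge> 1\<close>) of \<open>\<O>\<^bsub>\<complex>\<times>Z,0\<^esub>\<close>.\<close>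

definition tder :: "nat \<Rightarrow> mps \<Rightarrow> mps" where
  "tder i f = (if i = 0 then (mvar 0)\<^sup>2 * pdiff 0 f else mvar 0 * pdiff i f)"

text \<open>
  \<open>te_act M 0\<close> is the action of \<open>z\<^sub>0\<^sup>2\<partial>\<^sub>z\<^sub>0\<close>, and \<open>te_act M i\<close> for \<open>1 \<le> i \<le> te_dim M\<close> is the action
  of \<open>z\<^sub>0\<partial>\<^sub>z\<^sub>i\<close>, on the module \<open>freemod (te_dim M) (te_rank M)\<close>; other values of \<open>te_act M\<close> are
  irrelevant.
\<close>

record te =
  te_dim :: nat
  te_rank :: nat
  te_act :: "nat \<Rightarrow> (nat \<Rightarrow> mps) \<Rightarrow> (nat \<Rightarrow> mps)"

abbreviation te_module :: "te \<Rightarrow> (nat \<Rightarrow> mps) set" where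
  "te_module M \<equiv> freemod (te_dim M) (te_rank M)"

text \<open>
  The last two conditions say that \<open>\<nabla>\<close> is flat: \<open>[z\<^sub>0\<partial>\<^sub>z\<^sub>i, z\<^sub>0\<partial>\<^sub>z\<^sub>j] = 0\<close> and
  \<open>[z\<^sub>0\<^sup>2\<partial>\<^sub>z\<^sub>0, z\<^sub>0\<partial>\<^sub>z\<^sub>i] = z\<^sub>0 (z\<^sub>0\<partial>\<^sub>z\<^sub>i)\<close> hold for the action on the module.
\<close>

definition te_structure :: "te \<Rightarrow> bool" where
  "te_structure M \<longleftrightarrow>
     (\<forall>i\<le>te_dim M. \<forall>v\<in>te_module M. te_act M i v \<in> te_module M) \<and>
     (\<forall>i\<le>te_dim M. \<forall>u\<in>te_module M. \<forall>v\<in>te_module M.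
        te_act M i (vadd u v) = vadd (te_act M i u) (te_act M i v)) \<and>
     (\<forall>i\<le>te_dim M. \<forall>f\<in>germs (te_dim M). \<forall>v\<in>te_module M.
        te_act M i (smul f v) = vadd (smul (tder i f) v) (smul f (te_act M i v))) \<and>
     (\<forall>i\<in>{1..te_dim M}. \<forall>j\<in>{1..te_dim M}. \<forall>v\<in>te_module M.
        te_act M i (te_act M j v) = te_act M j (te_act M i v)) \<and>
     (\<forall>i\<in>{1..te_dim M}. \<forall>v\<in>te_module M.
        te_act M 0 (te_act M i v) =
          vadd (te_act M i (te_act M 0 v)) (smul (mvar 0) (te_act M i v)))"

definition te_iso :: "te \<Rightarrow> te \<Rightarrow> ((nat \<Rightarrow> mps) \<Rightarrow> (nat \<Rightarrow> mps)) \<Rightarrow> bool" where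
  "te_iso M N \<phi> \<longleftrightarrow> te_dim M = te_dim N \<and> bij_betw \<phi> (te_module M) (te_module N) \<and>
     (\<forall>u\<in>te_module M. \<forall>v\<in>te_module M. \<phi> (vadd u v) = vadd (\<phi> u) (\<phi> v)) \<and>
     (\<forall>f\<in>germs (te_dim M). \<forall>v\<in>te_module M. \<phi> (smul f v) = smul f (\<phi> v)) \<and>
     (\<forall>i\<le>te_dim M. \<forall>v\<in>te_module M. \<phi> (te_act M i v) = te_act N i (\<phi> v))"


section \<open>Pull-backs\<close>

text \<open>
  \<open>g\<^sup>*M\<close> for \<open>g : (\<complex>\<^sup>m, 0) \<rightarrow> (\<complex>\<^sup>n, 0)\<close>.  Its connection is the one with
  \<open>z\<^sub>0\<^sup>2\<partial>\<^sub>z\<^sub>0 (1 \<otimes> e\<^sub>a) = 1 \<otimes> z\<^sub>0\<^sup>2\<partial>\<^sub>z\<^sub>0 e\<^sub>a\<close> and \<open>z\<^sub>0\<partial>\<^sub>z\<^sub>j (1 \<otimes> e\<^sub>a) = \<Sum>\<^sub>i \<partial>\<^sub>jg\<^sub>i \<otimes> z\<^sub>0\<partial>\<^sub>z\<^sub>i e\<^sub>a\<close>,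
  extended by the Leibniz rule; \<open>pull_conn\<close> gives the component at \<open>1 \<otimes> e\<^sub>b\<close> of these.
\<close>

definition pull_conn :: "(nat \<Rightarrow> mps) \<Rightarrow> te \<Rightarrow> nat \<Rightarrow> nat \<Rightarrow> nat \<Rightarrow> mps" where
  "pull_conn g M j a b =
     (if j = 0 then germ_pull (te_dim M) g (te_act M 0 (unitvec a) b)
      else \<Sum>i=1..te_dim M. pdiff j (g i) * germ_pull (te_dim M) g (te_act M i (unitvec a) b))"

definition te_pull :: "nat \<Rightarrow> (nat \<Rightarrow> mps) \<Rightarrow> te \<Rightarrow> te" where
  "te_pull m g M = \<lparr>te_dim = m, te_rank = te_rank M,
     te_act = (\<lambda>j v b. tder j (v b) + (\<Sum>a<te_rank M. v a * pull_conn g M j a b))\<rparr>"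

text \<open>Pull-back of an \<open>\<O>\<close>-linear map \<open>\<phi>\<close> from \<open>freemod n k\<close>: it maps \<open>1 \<otimes> e\<^sub>a\<close> to \<open>1 \<otimes> \<phi> e\<^sub>a\<close>.\<close>

definition hom_pull ::
  "nat \<Rightarrow> nat \<Rightarrow> (nat \<Rightarrow> mps) \<Rightarrow> ((nat \<Rightarrow> mps) \<Rightarrow> (nat \<Rightarrow> mps)) \<Rightarrow> (nat \<Rightarrow> mps) \<Rightarrow> (nat \<Rightarrow> mps)" where
  "hom_pull n k g \<phi> v = (\<lambda>b. \<Sum>a<k. v a * germ_pull n g (\<phi> (unitvec a) b))"

text \<open>
  Restriction to \<open>\<complex> \<times> {0}\<close>, that is, pull-back under the inclusion of the point \<open>0\<close> in \<open>(Z, 0)\<close>.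
\<close>

definition te_restrict :: "te \<Rightarrow> te" where
  "te_restrict M = te_pull 0 (\<lambda>_. 0) M"

definition hom_restrict ::
  "te \<Rightarrow> ((nat \<Rightarrow> mps) \<Rightarrow> (nat \<Rightarrow> mps)) \<Rightarrow> (nat \<Rightarrow> mps) \<Rightarrow> (nat \<Rightarrow> mps)" where
  "hom_restrict M = hom_pull (te_dim M) (te_rank M) (\<lambda>_. 0)"


text \<open>
  Restriction is compatible with pull-back: with the modules \<open>\<O>\<^sup>k\<close> used here, the canonical
  identification of the restrictions of \<open>g\<^sup>*M\<close> and of \<open>M\<close> to \<open>\<complex> \<times> {0}\<close> is the identity
  (\<open>te_restrict_pull\<close> below).
\<close>

lemma mcoeff_mult: "mcoeff (f * g) \<alpha> = (\<Sum>\<beta> | \<beta> \<subseteq># \<alpha>. mcoeff f \<beta> * mcoeff g (\<alpha> - \<beta>))"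
  by transfer simp

lemma mcoeff_mvar_mult:
  "mcoeff (mvar i * f) \<gamma> = (if i \<in># \<gamma> then mcoeff f (\<gamma> - {#i#}) else 0)"
proof -
  have "mcoeff (mvar i * f) \<gamma> = (\<Sum>\<beta> | \<beta> \<subseteq># \<gamma>. if \<beta> = {#i#} then mcoeff f (\<gamma> - {#i#}) else 0)"
    unfolding mcoeff_mult by (intro sum.cong) (auto simp: mvar.rep_eq)
  then show ?thesis by (simp add: sum.delta)
qed

lemma mcoeff_monomial: "mcoeff (\<Prod>i\<in>#\<alpha>. mvar i) \<gamma> = (if \<gamma> = \<alpha> then 1 else 0)"
proof (induction \<alpha> arbitrary: \<gamma>)
  case empty
  show ?case by (simp add: one_mps.rep_eq)
next
  case (add x \<alpha>)
  have "(x \<in># \<gamma> \<and> \<gamma> - {#x#} = \<alpha>) \<longleftrightarrow> \<gamma> = add_mset x \<alpha>" by auto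
  with add show ?case by (auto simp: mcoeff_mvar_mult)
qed

lemma mult_vanish:
  assumes "\<And>\<gamma>. set_mset \<gamma> \<subseteq> {0} \<Longrightarrow> mcoeff h \<gamma> = 0" "set_mset \<gamma> \<subseteq> {0}"
  shows "mcoeff (h * f) \<gamma> = 0"
  unfolding mcoeff_mult
  by (intro sum.neutral) (use assms in \<open>auto dest!: set_mset_mono\<close>)

lemma mcoeff_msubst:
  "mcoeff (msubst n G f) \<gamma> = (\<Sum>\<alpha> | set_mset \<alpha> \<subseteq> {..n} \<and> size \<alpha> \<le> size \<gamma>.
      mcoeff f \<alpha> * mcoeff (\<Prod>i\<in>#\<alpha>. G i) \<gamma>)"
  by (simp add: msubst_def Abs_mps_inverse)

lemma prod_pure:
  assumes g: "\<And>i \<gamma>. i \<in> {1..n} \<Longrightarrow> set_mset \<gamma> \<subseteq> {0} \<Longrightarrow> mcoeff (g i) \<gamma> = 0"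
    and \<gamma>: "set_mset \<gamma> \<subseteq> {0}" and \<alpha>: "set_mset \<alpha> \<subseteq> {..n}"
  shows "mcoeff (\<Prod>i\<in>#\<alpha>. (g(0 := mvar 0)) i) \<gamma> = (if \<gamma> = \<alpha> then 1 else 0)"
proof (cases "set_mset \<alpha> \<subseteq> {0}")
  case True
  then have "image_mset (g(0 := mvar 0)) \<alpha> = image_mset mvar \<alpha>"
    by (intro image_mset_cong) auto
  then show ?thesis by (metis mcoeff_monomial)
next
  case False
  then obtain i where i: "i \<in># \<alpha>" "i \<noteq> 0" by auto
  then obtain \<beta> where b: "\<alpha> = add_mset i \<beta>" by (meson mset_add)
  have "mcoeff (g i * (\<Prod>i\<in>#\<beta>. (g(0 := mvar 0)) i)) \<gamma> = 0"
    by (rule mult_vanish[OF _ \<gamma>], rule g) (use i \<alpha> in auto)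
  with i b False \<gamma> show ?thesis by auto
qed

lemma finite_bounded_multisets: "finite {\<alpha>. set_mset \<alpha> \<subseteq> {..n::nat} \<and> size \<alpha> \<le> k}"
proof (induction k)
  case 0 show ?case by (rule finite_subset[of _ "{{#}}"]) auto
next
  case (Suc k)
  have "{\<alpha>. set_mset \<alpha> \<subseteq> {..n::nat} \<and> size \<alpha> \<le> Suc k} \<subseteq>
        insert {#} ((\<lambda>(i,\<alpha>). add_mset i \<alpha>) ` ({..n} \<times> {\<alpha>. set_mset \<alpha> \<subseteq> {..n::nat} \<and> size \<alpha> \<le> k}))"
  proof
    fix \<alpha> assume "\<alpha> \<in> {\<alpha>. set_mset \<alpha> \<subseteq> {..n::nat} \<and> size \<alpha> \<le> Suc k}"
    then show "\<alpha> \<in>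
        insert {#} ((\<lambda>(i,\<alpha>). add_mset i \<alpha>) ` ({..n} \<times> {\<alpha>. set_mset \<alpha> \<subseteq> {..n::nat} \<and> size \<alpha> \<le> k}))"
      by (cases \<alpha>) (auto intro!: image_eqI)
  qed
  with Suc show ?case by (meson finite_SigmaI finite_atMost finite_imageI finite_insert finite_subset)
qed

lemma germ_pull_pure:
  assumes g: "\<And>i \<gamma>. i \<in> {1..n} \<Longrightarrow> set_mset \<gamma> \<subseteq> {0} \<Longrightarrow> mcoeff (g i) \<gamma> = 0"
    and \<gamma>: "set_mset \<gamma> \<subseteq> {0}"
  shows "mcoeff (germ_pull n g f) \<gamma> = mcoeff f \<gamma>"
proof -
  have pp: "mcoeff (\<Prod>i\<in>#\<alpha>. (g(0 := mvar 0)) i) \<gamma> = (if \<gamma> = \<alpha> then 1 else 0)"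
    if "set_mset \<alpha> \<subseteq> {..n}" for \<alpha>
    by (rule prod_pure[where n=n]) (use g \<gamma> that in auto)
  have "mcoeff (germ_pull n g f) \<gamma> =
      (\<Sum>\<alpha> | set_mset \<alpha> \<subseteq> {..n} \<and> size \<alpha> \<le> size \<gamma>. if \<alpha> = \<gamma> then mcoeff f \<gamma> else 0)"
    unfolding germ_pull_def mcoeff_msubst by (intro sum.cong) (auto simp: pp simp del: fun_upd_apply)
  also have "\<dots> = mcoeff f \<gamma>"
    using \<gamma> finite_bounded_multisets[of n "size \<gamma>"] by (subst sum.delta) auto
  finally show ?thesis .
qed

lemma germ_pull_0: "mcoeff (germ_pull n (\<lambda>_. 0) f) \<gamma> = (if set_mset \<gamma> \<subseteq> {0} then mcoeff f \<gamma> else 0)"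
proof (cases "set_mset \<gamma> \<subseteq> {0}")
  case True then show ?thesis by (simp add: germ_pull_pure zero_mps.rep_eq)
next
  case False
  have "mcoeff (\<Prod>i\<in>#\<alpha>. ((\<lambda>_. 0)(0 := mvar 0)) i) \<gamma> = 0" for \<alpha> :: "nat multiset"
  proof (cases "set_mset \<alpha> \<subseteq> {0}")
    case True
    then have "image_mset ((\<lambda>_. 0)(0 := mvar 0)) \<alpha> = image_mset mvar \<alpha>"
      by (intro image_mset_cong) auto
    with True False show ?thesis by (metis mcoeff_monomial)
  next
    case False
    then obtain i where i: "i \<in># \<alpha>" "i \<noteq> 0" by auto
    then obtain \<beta> where b: "\<alpha> = add_mset i \<beta>" by (meson mset_add)
    with i show ?thesis by (simp add: zero_mps.rep_eq)
  qed
  with False show ?thesis unfolding germ_pull_def mcoeff_msubst by (auto simp del: fun_upd_apply)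
qed

lemma germ_map_pure: "germ_map m n g \<Longrightarrow> i \<in> {1..n} \<Longrightarrow> set_mset \<gamma> \<subseteq> {0} \<Longrightarrow> mcoeff (g i) \<gamma> = 0"
  unfolding germ_map_def base_germs_def
  by (cases "\<gamma> = {#}")
     (simp, metis (mono_tags, lifting) mem_Collect_eq multiset_nonemptyE singletonD subsetD)

lemma te_restrict_pull:
  assumes "germ_map m (te_dim M) g"
  shows "te_dim (te_restrict (te_pull m g M)) = te_dim (te_restrict M)"
    "te_rank (te_restrict (te_pull m g M)) = te_rank (te_restrict M)"
    "te_act (te_restrict (te_pull m g M)) 0 v = te_act (te_restrict M) 0 v"
proof -
  have t0: "tder 0 1 = 0" "tder 0 0 = 0"
  proof -
    have "pdiff 0 1 = 0" "pdiff 0 0 = 0" by (transfer, auto)+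
    then show "tder 0 1 = 0" "tder 0 0 = 0" by (auto simp: tder_def)
  qed
  have "te_act (te_pull m g M) 0 (unitvec a) b = germ_pull (te_dim M) g (te_act M 0 (unitvec a) b)"
    if "a < te_rank M" for a b
  proof -
    have "(\<Sum>c<te_rank M. unitvec a c * pull_conn g M 0 c b) =
        (\<Sum>c<te_rank M. if c = a then pull_conn g M 0 a b else 0)"
      by (intro sum.cong) (auto simp: unitvec_def)
    then show ?thesis using that t0 by (simp add: te_pull_def unitvec_def pull_conn_def)
  qed
  moreover have "germ_pull m (\<lambda>_. 0) (germ_pull (te_dim M) g f) = germ_pull (te_dim M) (\<lambda>_. 0) f" for f
    by (rule mps_eqI) (use germ_pull_pure[of "te_dim M" g, OF germ_map_pure[OF assms]] in \<open>auto simp: germ_pull_0\<close>)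
  ultimately show "te_act (te_restrict (te_pull m g M)) 0 v = te_act (te_restrict M) 0 v"
    by (auto simp: te_restrict_def te_pull_def[of 0] pull_conn_def
        te_pull_def[of m, THEN arg_cong[where f=te_dim]]
        te_pull_def[of m, THEN arg_cong[where f=te_rank]]
        intro!: sum.cong)
qed (auto simp: te_restrict_def te_pull_def)

section \<open>Versal deformations\<close>

definition te_deformation :: "te \<Rightarrow> te \<Rightarrow> ((nat \<Rightarrow> mps) \<Rightarrow> (nat \<Rightarrow> mps)) \<Rightarrow> bool" where
  "te_deformation B M \<tau> \<longleftrightarrow> te_structure M \<and> te_iso (te_restrict M) B \<tau>"

definition deformation_iso ::
  "te \<Rightarrow> ((nat \<Rightarrow> mps) \<Rightarrow> (nat \<Rightarrow> mps)) \<Rightarrow> te \<Rightarrow> ((nat \<Rightarrow> mps) \<Rightarrow> (nat \<Rightarrow> mps)) \<Rightarrow>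
   ((nat \<Rightarrow> mps) \<Rightarrow> (nat \<Rightarrow> mps)) \<Rightarrow> bool" where
  "deformation_iso M \<tau> N \<sigma> \<phi> \<longleftrightarrow> te_iso M N \<phi> \<and>
     (\<forall>v\<in>te_module (te_restrict M). \<sigma> (hom_restrict M \<phi> v) = \<tau> v)"

text \<open>
  By \<open>te_restrict_pull\<close>, the pull-back of the deformation \<open>(M, \<tau>)\<close> under \<open>g\<close> is \<open>(g\<^sup>*M, \<tau>)\<close>.
\<close>

definition versal_deformation :: "te \<Rightarrow> te \<Rightarrow> ((nat \<Rightarrow> mps) \<Rightarrow> (nat \<Rightarrow> mps)) \<Rightarrow> bool" where
  "versal_deformation B M \<tau> \<longleftrightarrow> te_deformation B M \<tau> \<and>
     (\<forall>M' \<tau>'. te_deformation B M' \<tau>' \<longrightarrow>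
        (\<exists>g \<phi>. germ_map (te_dim M') (te_dim M) g \<and>
               deformation_iso M' \<tau>' (te_pull (te_dim M') g M) \<tau> \<phi>))"


section \<open>The \<open>TE\<close>-structure \<open>\<B>\<^sup>F\<close>\<close>

text \<open>
  The action with \<open>z\<^sub>0\<^sup>2\<partial>\<^sub>z\<^sub>0 f\<^sub>j = (j+1) z\<^sub>0 f\<^sub>j\<close> on the basis \<open>f\<^sub>0, \<dots>, f\<^sub>r\<close>, extended by the Leibniz
  rule.
\<close>

definition BF :: "nat \<Rightarrow> te" where
  "BF r = \<lparr>te_dim = 0, te_rank = r + 1,
     te_act = (\<lambda>i v j. tder i (v j) + of_nat (j + 1) * mvar 0 * v j)\<rparr>"

end

theory Submission
  imports Defs
begin

text \<open>
  A deformation \<open>M\<close> of \<open>\<B>\<^sup>F\<close> has a Higgs field at the closed point: \<open>z\<^sub>0\<nabla>\<^sub>X\<close> induces an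
  \<open>\<O>\<close>-linear endomorphism of \<open>M/z\<^sub>0M\<close>, whose value at \<open>0\<close> depends only on the tangent vector
  \<open>X \<in> T\<^sub>0Z\<close>.  The identification of the restriction with \<open>\<B>\<^sup>F\<close> turns it into a linear map
  \<open>T\<^sub>0Z \<rightarrow> End(\<complex>\<^sup>r\<^sup>+\<^sup>1)\<close> that is an invariant of the deformation and is composed with \<open>dg\<close> under
  pull-back by \<open>g\<close>.  Flatness makes its image commutative (\<open>higgs_along_commute\<close>).

  If \<open>M\<close> is versal, this image contains the Higgs field of every deformation over \<open>(\<complex>, 0)\<close>
  (\<open>shift_te_intertwines\<close>).  But both elementary endomorphisms \<open>f\<^sub>0 \<mapsto> f\<^sub>1\<close> and \<open>f\<^sub>1 \<mapsto> f\<^sub>2\<close> occur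
  as such Higgs fields (\<open>te_deformation_shift_te\<close>): they raise the eigenvalue of the residue of
  \<open>\<B>\<^sup>F\<close> by exactly \<open>1\<close>, which is the flatness condition when the action of \<open>z\<^sub>0\<^sup>2\<partial>\<^sub>z\<^sub>0\<close> is kept
  constant.  For \<open>r \<ge> 2\<close> both exist, and they do not commute: composed in one order they send
  \<open>f\<^sub>0\<close> to \<open>f\<^sub>2\<close>, in the other order to \<open>0\<close>.  So the fibre at \<open>0\<close> of the identification would
  kill \<open>f\<^sub>2\<close>, contrary to its being an isomorphism (\<open>fibre_nonzero\<close>).
\<close>

section \<open>Partial derivatives of power series\<close>

lemma mcoeff_const_mult: "mcoeff (f * g) {#} = mcoeff f {#} * mcoeff g {#}"
  by (simp add: mcoeff_mult)

lemma mcoeff_sum: "mcoeff (\<Sum>a\<in>A. f a) \<gamma> = (\<Sum>a\<in>A. mcoeff (f a) \<gamma>)"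
  by (induction A rule: infinite_finite_induct) (auto simp: zero_mps.rep_eq plus_mps.rep_eq)

lemma mcoeff_of_nat_mult: "mcoeff (of_nat c * f) \<gamma> = of_nat c * mcoeff f \<gamma>"
  by (induction c) (auto simp: zero_mps.rep_eq plus_mps.rep_eq algebra_simps)

lemma mvar_mult_cancel: "mvar i * f = mvar i * g \<Longrightarrow> f = g"
proof (rule mps_eqI)
  fix \<alpha> assume "mvar i * f = mvar i * g"
  then have "mcoeff (mvar i * f) (add_mset i \<alpha>) = mcoeff (mvar i * g) (add_mset i \<alpha>)" by simp
  then show "mcoeff f \<alpha> = mcoeff g \<alpha>" by (simp add: mcoeff_mvar_mult)
qed

lemma mcoeff_euler: "mcoeff (mvar i * pdiff i f) \<alpha> = of_nat (count \<alpha> i) * mcoeff f \<alpha>"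
  by (auto simp: mcoeff_mvar_mult pdiff.rep_eq not_in_iff simp flip: of_nat_Suc)

lemma pdiff_add: "pdiff i (f + g) = pdiff i f + pdiff i g"
  by transfer (auto simp: algebra_simps)

lemma pdiff_0: "pdiff i 0 = 0"
  by transfer auto

lemma pdiff_commute: "pdiff i (pdiff j f) = pdiff j (pdiff i f)"
  by transfer (auto simp: add_mset_commute)

lemma pdiff_mvar: "pdiff i (mvar j) = (if i = j then 1 else 0)"
  by transfer (auto simp: fun_eq_iff)

text \<open>
  The Euler operator \<open>z\<^sub>i\<partial>\<^sub>i\<close> multiplies the coefficient at \<open>\<alpha>\<close> by the exponent of \<open>z\<^sub>i\<close>, which is
  additive in \<open>\<alpha>\<close>; so it satisfies the Leibniz rule, and the factor \<open>z\<^sub>i\<close> can be cancelled.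
\<close>

lemma pdiff_mult: "pdiff i (f * g) = pdiff i f * g + f * pdiff i g"
proof (rule mvar_mult_cancel[of i], rule mps_eqI)
  fix \<alpha>
  have "mcoeff (mvar i * (pdiff i f * g + f * pdiff i g)) \<alpha>
      = mcoeff ((mvar i * pdiff i f) * g) \<alpha> + mcoeff (f * (mvar i * pdiff i g)) \<alpha>"
    by (simp add: distrib_left plus_mps.rep_eq mult_ac)
  also have "\<dots> = (\<Sum>\<beta> | \<beta> \<subseteq># \<alpha>. of_nat (count \<beta> i + count (\<alpha> - \<beta>) i) * mcoeff f \<beta> * mcoeff g (\<alpha> - \<beta>))"
    unfolding mcoeff_mult[of _ g] mcoeff_mult[of f] mcoeff_euler
    by (simp add: algebra_simps sum.distrib)
  also have "\<dots> = (\<Sum>\<beta> | \<beta> \<subseteq># \<alpha>. of_nat (count \<alpha> i) * mcoeff f \<beta> * mcoeff g (\<alpha> - \<beta>))"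
    by (intro sum.cong refl)
       (metis (no_types, lifting) count_union mem_Collect_eq msub(2))
  also have "\<dots> = mcoeff (mvar i * pdiff i (f * g)) \<alpha>"
    unfolding mcoeff_euler mcoeff_mult[of f g] by (simp add: sum_distrib_left mult.assoc)
  finally show "mcoeff (mvar i * pdiff i (f * g)) \<alpha>
      = mcoeff (mvar i * (pdiff i f * g + f * pdiff i g)) \<alpha>" by simp
qed

lemma tder_0: "tder i 0 = 0"
  by (simp add: tder_def pdiff_0)

lemma tder_add: "tder i (f + g) = tder i f + tder i g"
  by (simp add: tder_def pdiff_add algebra_simps)

lemma tder_mult: "tder i (f * g) = tder i f * g + f * tder i g"
  by (simp add: tder_def pdiff_mult algebra_simps)

lemma tder_1: "tder i 1 = 0"
  using tder_mult[of i 1 1] by simp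

lemma tder_of_nat: "tder i (of_nat c) = 0"
  by (induction c) (auto simp: tder_0 tder_1 tder_add)

lemma mcoeff_const_tder: "mcoeff (tder i f) {#} = 0"
  by (simp add: tder_def power2_eq_square mult.assoc mcoeff_mvar_mult)

lemma tder_bracket: "tder 0 (tder 1 f) = tder 1 (tder 0 f) + mvar 0 * tder 1 f"
  by (simp add: tder_def pdiff_mult pdiff_mvar pdiff_commute[of "Suc 0" 0] power2_eq_square algebra_simps)

section \<open>Operations on convergent power series\<close>

lemma germs_supportD: "f \<in> germs n \<Longrightarrow> mcoeff f \<alpha> \<noteq> 0 \<Longrightarrow> set_mset \<alpha> \<subseteq> {..n}"
  by (auto simp: germs_def)

lemma germs_radius:
  assumes "f \<in> germs n"
  obtains \<rho> where "\<rho> > 0" "(\<lambda>\<alpha>. norm (mcoeff f \<alpha>) * \<rho> ^ size \<alpha>) summable_on UNIV"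
  using assms by (auto simp: germs_def)

lemma germsI:
  assumes "\<And>\<alpha>. mcoeff f \<alpha> \<noteq> 0 \<Longrightarrow> set_mset \<alpha> \<subseteq> {..n}"
    and "h summable_on UNIV" "\<rho> > 0" "\<And>\<alpha>. norm (mcoeff f \<alpha>) * \<rho> ^ size \<alpha> \<le> h \<alpha>"
  shows "f \<in> germs n"
proof -
  have "(\<lambda>\<alpha>. norm (mcoeff f \<alpha>) * \<rho> ^ size \<alpha>) summable_on UNIV"
    by (rule summable_on_comparison_test[OF assms(2)]) (use assms in auto)
  with assms show ?thesis unfolding germs_def by blast
qed

lemma germs_0: "0 \<in> germs n"
  by (rule germsI[where h="\<lambda>_. 0" and \<rho>=1]) (auto simp: zero_mps.rep_eq)

lemma germs_1: "1 \<in> germs n"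
proof (rule germsI[where h="\<lambda>\<alpha>. if \<alpha> = {#} then 1 else 0" and \<rho>=1])
  show "(\<lambda>\<alpha>. if \<alpha> = {#} then 1 else 0 :: real) summable_on UNIV"
    by (rule summable_on_cong_neutral[where T="{{#}}", THEN iffD2, OF _ _ _ summable_on_finite]) auto
qed (auto simp: one_mps.rep_eq split: if_splits)

lemma germs_add:
  assumes f: "f \<in> germs n" and g: "g \<in> germs n"
  shows "f + g \<in> germs n"
proof -
  obtain \<rho> where \<rho>: "\<rho> > 0" "(\<lambda>\<alpha>. norm (mcoeff f \<alpha>) * \<rho> ^ size \<alpha>) summable_on UNIV"
    using f by (rule germs_radius)
  obtain \<sigma> where \<sigma>: "\<sigma> > 0" "(\<lambda>\<alpha>. norm (mcoeff g \<alpha>) * \<sigma> ^ size \<alpha>) summable_on UNIV"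
    using g by (rule germs_radius)
  show ?thesis
  proof (rule germsI[OF _ summable_on_add[OF \<rho>(2) \<sigma>(2)], where \<rho>="min \<rho> \<sigma>"])
    fix \<alpha>
    show "mcoeff (f + g) \<alpha> \<noteq> 0 \<Longrightarrow> set_mset \<alpha> \<subseteq> {..n}"
      using germs_supportD[OF f] germs_supportD[OF g] by (force simp: plus_mps.rep_eq)
    have "norm (mcoeff (f + g) \<alpha>) * min \<rho> \<sigma> ^ size \<alpha>
        \<le> norm (mcoeff f \<alpha>) * min \<rho> \<sigma> ^ size \<alpha> + norm (mcoeff g \<alpha>) * min \<rho> \<sigma> ^ size \<alpha>"
      using \<rho>(1) \<sigma>(1)
      by (metis plus_mps.rep_eq distrib_right mult_right_mono norm_triangle_ineq min_less_iff_conj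
          order_less_imp_le zero_le_power)
    also have "\<dots> \<le> norm (mcoeff f \<alpha>) * \<rho> ^ size \<alpha> + norm (mcoeff g \<alpha>) * \<sigma> ^ size \<alpha>"
      using \<rho>(1) \<sigma>(1) by (intro add_mono mult_left_mono power_mono) auto
    finally show "norm (mcoeff (f + g) \<alpha>) * min \<rho> \<sigma> ^ size \<alpha>
        \<le> norm (mcoeff f \<alpha>) * \<rho> ^ size \<alpha> + norm (mcoeff g \<alpha>) * \<sigma> ^ size \<alpha>" .
  qed (use \<rho> \<sigma> in auto)
qed

lemma germs_of_nat_mult: "f \<in> germs n \<Longrightarrow> of_nat c * f \<in> germs n"
  by (induction c) (auto simp: germs_0 germs_add algebra_simps)

lemma germs_mvar_mult:
  assumes f: "f \<in> germs n" and i: "i \<le> n"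
  shows "mvar i * f \<in> germs n"
proof -
  obtain \<rho> where \<rho>: "\<rho> > 0" "(\<lambda>\<alpha>. norm (mcoeff f \<alpha>) * \<rho> ^ size \<alpha>) summable_on UNIV"
    using f by (rule germs_radius)
  let ?h = "\<lambda>\<gamma>. norm (mcoeff (mvar i * f) \<gamma>) * \<rho> ^ size \<gamma>"
  have "(?h \<circ> add_mset i) summable_on UNIV"
    using summable_on_cmult_right[OF \<rho>(2), of \<rho>] by (simp add: o_def mcoeff_mvar_mult mult.left_commute)
  then have "?h summable_on range (add_mset i)"
    by (subst summable_on_reindex) (auto simp: inj_on_def)
  then have "?h summable_on UNIV"
    by (rule summable_on_cong_neutral[THEN iffD1, rotated -1])
       (auto simp: mcoeff_mvar_mult image_iff dest: multi_member_split)
  then show ?thesis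
    by (rule germsI[rotated, OF _ \<rho>(1)])
       (use germs_supportD[OF f] i in \<open>auto simp: mcoeff_mvar_mult split: if_splits,
         metis add_mset_remove_trivial_eq atMost_iff insert_iff insert_DiffM set_mset_add_mset_insert subsetD\<close>)
qed

lemma summable_shift:
  assumes "(\<lambda>\<alpha>. norm (mcoeff f \<alpha>) * \<rho> ^ size \<alpha>) summable_on UNIV" "\<rho> > 0"
  shows "(\<lambda>\<alpha>. norm (mcoeff f (add_mset i \<alpha>)) * \<rho> ^ size \<alpha>) summable_on UNIV"
proof -
  let ?h = "\<lambda>\<alpha>. norm (mcoeff f \<alpha>) * \<rho> ^ size \<alpha>"
  have "?h summable_on range (add_mset i)"
    using assms(1) by (rule summable_on_subset_banach) auto
  then have "(?h \<circ> add_mset i) summable_on UNIV"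
    by (subst (asm) summable_on_reindex) (auto simp: inj_on_def)
  from summable_on_cmult_right[OF this, of "1 / \<rho>"] assms(2) show ?thesis
    by (simp add: o_def)
qed

text \<open>The factor \<open>count \<alpha> i + 1\<close> is absorbed by halving the radius, as \<open>m + 1 \<le> 2\<^sup>m\<close>.\<close>

lemma germs_pdiff:
  assumes f: "f \<in> germs n"
  shows "pdiff i f \<in> germs n"
proof -
  obtain \<rho> where \<rho>: "\<rho> > 0" "(\<lambda>\<alpha>. norm (mcoeff f \<alpha>) * \<rho> ^ size \<alpha>) summable_on UNIV"
    using f by (rule germs_radius)
  show ?thesis
  proof (rule germsI[OF _ summable_shift[OF \<rho>(2,1)], where \<rho>="\<rho> / 2"])
    fix \<alpha>
    show "mcoeff (pdiff i f) \<alpha> \<noteq> 0 \<Longrightarrow> set_mset \<alpha> \<subseteq> {..n}"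
      using germs_supportD[OF f, of "add_mset i \<alpha>"] by (auto simp: pdiff.rep_eq)
    have "count \<alpha> i + 1 \<le> size \<alpha> + 1"
      by (simp add: count_le_size)
    also have "\<dots> \<le> 2 ^ size \<alpha>"
      using less_exp[of "size \<alpha>"] by (metis Suc_eq_plus1 Suc_leI)
    finally have "real (count \<alpha> i + 1) \<le> real (2 ^ size \<alpha>)"
      by (rule of_nat_mono)
    then have "real (count \<alpha> i + 1) * (\<rho> / 2) ^ size \<alpha> \<le> real (2 ^ size \<alpha>) * (\<rho> / 2) ^ size \<alpha>"
      using \<rho>(1) by (intro mult_right_mono) auto
    then have le: "real (count \<alpha> i + 1) * (\<rho> / 2) ^ size \<alpha> \<le> \<rho> ^ size \<alpha>"
      by (simp add: power_divide)
    have "norm (mcoeff (pdiff i f) \<alpha>) * (\<rho> / 2) ^ size \<alpha>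
        = norm (mcoeff f (add_mset i \<alpha>)) * (real (count \<alpha> i + 1) * (\<rho> / 2) ^ size \<alpha>)"
      unfolding pdiff.rep_eq norm_mult norm_of_nat by (simp only: mult_ac)
    also have "\<dots> \<le> norm (mcoeff f (add_mset i \<alpha>)) * \<rho> ^ size \<alpha>"
      by (intro mult_left_mono le) auto
    finally show "norm (mcoeff (pdiff i f) \<alpha>) * (\<rho> / 2) ^ size \<alpha>
        \<le> norm (mcoeff f (add_mset i \<alpha>)) * \<rho> ^ size \<alpha>" .
  qed (use \<rho> in auto)
qed

lemma germs_tder: "f \<in> germs n \<Longrightarrow> tder i f \<in> germs n"
  by (simp add: tder_def power2_eq_square mult.assoc germs_mvar_mult germs_pdiff)

lemma germs_restrict:
  assumes f: "f \<in> germs m"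
  shows "germ_pull m (\<lambda>_. 0) f \<in> germs 0"
proof -
  obtain \<rho> where \<rho>: "\<rho> > 0" "(\<lambda>\<alpha>. norm (mcoeff f \<alpha>) * \<rho> ^ size \<alpha>) summable_on UNIV"
    using f by (rule germs_radius)
  show ?thesis
    by (rule germsI[OF _ \<rho>(2,1)]) (use \<rho>(1) in \<open>auto simp: germ_pull_0 split: if_splits\<close>)
qed

lemma germs_0_divide:
  assumes f: "f \<in> germs 0" and f0: "mcoeff f {#} = 0"
  shows "\<exists>h\<in>germs 0. f = mvar 0 * h"
proof -
  define h where "h = Abs_mps (\<lambda>\<alpha>. mcoeff f (add_mset 0 \<alpha>))"
  have h: "mcoeff h \<alpha> = mcoeff f (add_mset 0 \<alpha>)" for \<alpha>
    by (simp add: h_def Abs_mps_inverse)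
  obtain \<rho> where \<rho>: "\<rho> > 0" "(\<lambda>\<alpha>. norm (mcoeff f \<alpha>) * \<rho> ^ size \<alpha>) summable_on UNIV"
    using f by (rule germs_radius)
  have "h \<in> germs 0"
    by (rule germsI[OF _ summable_shift[OF \<rho>(2,1), of 0] \<rho>(1)])
       (use germs_supportD[OF f] in \<open>auto simp: h dest!: germs_supportD[OF f]\<close>)
  moreover have "f = mvar 0 * h"
  proof (rule mps_eqI)
    fix \<gamma>
    have "mcoeff f \<gamma> = 0" if "0 \<notin># \<gamma>"
    proof (rule ccontr)
      assume nz: "mcoeff f \<gamma> \<noteq> 0"
      from germs_supportD[OF f nz] that have "\<gamma> = {#}"
        by (cases \<gamma>) auto
      with nz f0 show False by simp
    qed
    then show "mcoeff f \<gamma> = mcoeff (mvar 0 * h) \<gamma>"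
      by (auto simp: mcoeff_mvar_mult h)
  qed
  ultimately show ?thesis by blast
qed

section \<open>Maps on free modules at the closed point\<close>

lemma freemodD: "v \<in> freemod n k \<Longrightarrow> a < k \<Longrightarrow> v a \<in> germs n" "v \<in> freemod n k \<Longrightarrow> a \<ge> k \<Longrightarrow> v a = 0"
  by (auto simp: freemod_def)

lemma smul_unitvec_in_freemod: "f \<in> germs n \<Longrightarrow> a < k \<Longrightarrow> smul f (unitvec a) \<in> freemod n k"
  by (auto simp: freemod_def smul_def unitvec_def germs_0)

lemma unitvec_in_freemod: "a < k \<Longrightarrow> unitvec a \<in> freemod n k"
  by (auto simp: freemod_def unitvec_def germs_0 germs_1)

text \<open>
  An additive map that is \<open>\<O>\<close>-linear up to terms vanishing at \<open>0\<close> induces a linear map between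
  the fibres at \<open>0\<close>.  This covers homomorphisms as well as the actions of \<open>z\<^sub>0\<^sup>2\<partial>\<^sub>z\<^sub>0\<close> and
  \<open>z\<^sub>0\<partial>\<^sub>z\<^sub>i\<close>, whose derivation part is divisible by \<open>z\<^sub>0\<close>.
\<close>

lemma fibre_map:
  assumes add: "\<And>u v. u \<in> freemod n k \<Longrightarrow> v \<in> freemod n k \<Longrightarrow> L (vadd u v) = vadd (L u) (L v)"
    and lin: "\<And>f a. f \<in> germs n \<Longrightarrow> a < k \<Longrightarrow>
      mcoeff (L (smul f (unitvec a)) b) {#} = mcoeff f {#} * mcoeff (L (unitvec a) b) {#}"
    and w: "w \<in> freemod n k"
  shows "mcoeff (L w b) {#} = (\<Sum>a<k. mcoeff (w a) {#} * mcoeff (L (unitvec a) b) {#})"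
proof -
  define t where "t m = (\<lambda>a. if a < m then w a else 0)" for m :: nat
  have t: "t m \<in> freemod n k" for m
    using w by (auto simp: t_def freemod_def germs_0)
  have "mcoeff (L (t m) b) {#} = (\<Sum>a<m. mcoeff (w a) {#} * mcoeff (L (unitvec a) b) {#})"
    if "m \<le> k" for m
    using that
  proof (induction m)
    case 0
    have "vadd (t 0) (t 0) = t 0" by (simp add: vadd_def t_def)
    then have "L (t 0) b = L (t 0) b + L (t 0) b"
      using add[OF t[of 0] t[of 0]] by (metis vadd_def)
    then have "L (t 0) b = 0"
      by (metis add_cancel_right_right)
    then show ?case by (simp add: zero_mps.rep_eq)
  next
    case (Suc m)
    have wm: "w m \<in> germs n" using w Suc.prems by (auto intro: freemodD)
    have "t (Suc m) = vadd (t m) (smul (w m) (unitvec m))"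
      by (auto simp: t_def vadd_def smul_def unitvec_def fun_eq_iff less_Suc_eq)
    then have "L (t (Suc m)) b = L (t m) b + L (smul (w m) (unitvec m)) b"
      using add[OF t[of m] smul_unitvec_in_freemod[OF wm]] Suc.prems by (simp add: vadd_def)
    with Suc lin[OF wm] show ?case by (simp add: plus_mps.rep_eq)
  qed
  from this[of k] have "mcoeff (L (t k) b) {#} =
      (\<Sum>a<k. mcoeff (w a) {#} * mcoeff (L (unitvec a) b) {#})" by simp
  moreover have "t k = w"
    using w by (auto simp: t_def fun_eq_iff freemod_def)
  ultimately show ?thesis by simp
qed

section \<open>The Higgs field at the closed point\<close>

text \<open>
  The matrix at \<open>0\<close> of the endomorphism of \<open>M/z\<^sub>0M\<close> induced by \<open>z\<^sub>0\<partial>\<^sub>z\<^sub>i\<close>, acting on row vectors.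
\<close>

definition higgs :: "te \<Rightarrow> nat \<Rightarrow> nat \<Rightarrow> nat \<Rightarrow> complex" where
  "higgs M i a b = mcoeff (te_act M i (unitvec a) b) {#}"

lemma te_act_at_0:
  assumes M: "te_structure M" and i: "i \<le> te_dim M" and w: "w \<in> te_module M"
  shows "mcoeff (te_act M i w b) {#} = (\<Sum>a<te_rank M. mcoeff (w a) {#} * higgs M i a b)"
  unfolding higgs_def
proof (rule fibre_map[OF _ _ w])
  fix f a assume f: "f \<in> germs (te_dim M)" and a: "a < te_rank M"
  have "te_act M i (smul f (unitvec a)) =
      vadd (smul (tder i f) (unitvec a)) (smul f (te_act M i (unitvec a)))"
    using M i f unitvec_in_freemod[OF a] unfolding te_structure_def by blast
  then show "mcoeff (te_act M i (smul f (unitvec a)) b) {#} =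
      mcoeff f {#} * mcoeff (te_act M i (unitvec a) b) {#}"
    by (simp add: vadd_def smul_def plus_mps.rep_eq mcoeff_const_mult mcoeff_const_tder)
qed (use M i in \<open>auto simp: te_structure_def\<close>)

lemma higgs_commute:
  assumes M: "te_structure M" and ij: "i \<in> {1..te_dim M}" "j \<in> {1..te_dim M}" and a: "a < te_rank M"
  shows "(\<Sum>b<te_rank M. higgs M i a b * higgs M j b c) =
         (\<Sum>b<te_rank M. higgs M j a b * higgs M i b c)"
proof -
  have e: "unitvec a \<in> te_module M" using a by (rule unitvec_in_freemod)
  have in_mod: "te_act M l (unitvec a) \<in> te_module M" if "l \<in> {1..te_dim M}" for l
    using M e that unfolding te_structure_def by auto
  have "te_act M i (te_act M j (unitvec a)) = te_act M j (te_act M i (unitvec a))"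
    using M e ij unfolding te_structure_def by blast
  then show ?thesis
    using te_act_at_0[OF M _ in_mod, of j i c] te_act_at_0[OF M _ in_mod, of i j c] ij
    by (simp add: higgs_def)
qed

definition higgs_along :: "te \<Rightarrow> (nat \<Rightarrow> complex) \<Rightarrow> nat \<Rightarrow> nat \<Rightarrow> complex" where
  "higgs_along M X a b = (\<Sum>i=1..te_dim M. X i * higgs M i a b)"

lemma higgs_along_commute:
  assumes M: "te_structure M" and a: "a < te_rank M"
  shows "(\<Sum>b<te_rank M. higgs_along M X a b * higgs_along M Y b c) =
         (\<Sum>b<te_rank M. higgs_along M Y a b * higgs_along M X b c)"
proof -
  have expand: "(\<Sum>b<te_rank M. higgs_along M X a b * higgs_along M Y b c) =
      (\<Sum>i=1..te_dim M. \<Sum>j=1..te_dim M. X i * Y j * (\<Sum>b<te_rank M. higgs M i a b * higgs M j b c))"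
    for X Y
  proof -
    have "(\<Sum>b<te_rank M. higgs_along M X a b * higgs_along M Y b c) =
        (\<Sum>b<te_rank M. \<Sum>i=1..te_dim M. \<Sum>j=1..te_dim M. X i * Y j * (higgs M i a b * higgs M j b c))"
      by (simp add: higgs_along_def sum_product mult_ac)
    also have "\<dots> = (\<Sum>i=1..te_dim M. \<Sum>b<te_rank M. \<Sum>j=1..te_dim M.
        X i * Y j * (higgs M i a b * higgs M j b c))"
      by (rule sum.swap)
    also have "\<dots> = (\<Sum>i=1..te_dim M. \<Sum>j=1..te_dim M. \<Sum>b<te_rank M.
        X i * Y j * (higgs M i a b * higgs M j b c))"
      by (rule sum.cong[OF refl], rule sum.swap)
    finally show ?thesis by (simp add: sum_distrib_left)
  qed
  show ?thesis
    unfolding expand by (subst sum.swap, intro sum.cong refl)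
      (subst higgs_commute[OF M _ _ a], auto simp: mult_ac)
qed

section \<open>Deformations over a disc whose Higgs field is an elementary matrix\<close>

text \<open>
  The connection of \<open>\<B>\<^sup>F\<close> extended constantly in \<open>z\<^sub>1\<close>, with \<open>z\<^sub>0\<partial>\<^sub>z\<^sub>1\<close> acting by the nilpotent
  endomorphism \<open>N : f\<^sub>s \<mapsto> f\<^sub>s\<^sub>+\<^sub>1\<close>.
\<close>

definition shift_te :: "nat \<Rightarrow> nat \<Rightarrow> te" where
  "shift_te r s = \<lparr>te_dim = 1, te_rank = r + 1,
     te_act = (\<lambda>i v b. tder i (v b) +
       (if i = 0 then of_nat (b + 1) * mvar 0 * v b else if b = Suc s then v s else 0))\<rparr>"

lemma shift_te_simps [simp]:
  "te_dim (shift_te r s) = 1" "te_rank (shift_te r s) = r + 1"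
  "te_act (shift_te r s) 0 v b = tder 0 (v b) + of_nat (b + 1) * mvar 0 * v b"
  "te_act (shift_te r s) (Suc 0) v b = tder 1 (v b) + (if b = Suc s then v s else 0)"
  by (simp_all add: shift_te_def)

text \<open>
  Flatness rests on the eigenvalues \<open>1, \<dots>, r + 1\<close> of \<open>D = z\<^sub>0\<partial>\<^sub>z\<^sub>0\<close> on the basis: as \<open>N\<close> raises the
  eigenvalue by \<open>1\<close>, \<open>[z\<^sub>0D, N] = z\<^sub>0N\<close>, and this is the contribution of \<open>N\<close> to the right-hand
  side of \<open>[z\<^sub>0\<^sup>2\<partial>\<^sub>z\<^sub>0, z\<^sub>0\<partial>\<^sub>z\<^sub>1] = z\<^sub>0 (z\<^sub>0\<partial>\<^sub>z\<^sub>1)\<close>.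
\<close>

lemma te_structure_shift_te:
  assumes s: "s < r"
  shows "te_structure (shift_te r s)"
proof -
  let ?A = "te_act (shift_te r s)"
  have closed: "?A 0 v \<in> freemod 1 (r + 1)" "?A (Suc 0) v \<in> freemod 1 (r + 1)"
    if v: "v \<in> freemod 1 (r + 1)" for v
  proof -
    show "?A 0 v \<in> freemod 1 (r + 1)"
      using freemodD[OF v]
      by (auto simp: freemod_def mult.assoc tder_0
          intro!: germs_add germs_tder germs_of_nat_mult germs_mvar_mult simp del: of_nat_add of_nat_Suc)
    show "?A (Suc 0) v \<in> freemod 1 (r + 1)"
      using freemodD[OF v] s by (auto simp: freemod_def tder_0 germs_0 intro!: germs_add germs_tder)
  qed
  have additive: "?A 0 (vadd u v) = vadd (?A 0 u) (?A 0 v)"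
    "?A (Suc 0) (vadd u v) = vadd (?A (Suc 0) u) (?A (Suc 0) v)" for u v
    by (auto simp: fun_eq_iff vadd_def tder_add algebra_simps)
  have leibniz: "?A 0 (smul f v) = vadd (smul (tder 0 f) v) (smul f (?A 0 v))"
    "?A (Suc 0) (smul f v) = vadd (smul (tder (Suc 0) f) v) (smul f (?A (Suc 0) v))" for f v
    by (auto simp: fun_eq_iff vadd_def smul_def tder_mult algebra_simps)
  have flat: "?A 0 (?A (Suc 0) v) = vadd (?A (Suc 0) (?A 0 v)) (smul (mvar 0) (?A (Suc 0) v))" for v
  proof
    fix b
    have "tder 1 (mvar 0) = 0" by (simp add: tder_def pdiff_mvar)
    then have t1: "tder 1 (of_nat c * mvar 0 * f) = of_nat c * mvar 0 * tder 1 f" for c f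
      by (simp only: tder_mult tder_of_nat mult_zero_left mult_zero_right add_0)
    show "?A 0 (?A (Suc 0) v) b =
      vadd (?A (Suc 0) (?A 0 v))
        (smul (mvar 0) (?A (Suc 0) v)) b"
    proof (cases "b = Suc s")
      case True
      show ?thesis
        by (simp only: shift_te_simps vadd_def smul_def tder_add t1 tder_bracket True simp_thms if_True)
           (simp add: algebra_simps)
    next
      case False
      show ?thesis
        by (simp only: shift_te_simps vadd_def smul_def tder_add tder_0 t1 tder_bracket False if_False)
           (simp add: algebra_simps)
    qed
  qed
  have index: "i \<le> 1 \<longleftrightarrow> i = 0 \<or> i = Suc 0" "{1..1} = {Suc 0}" for i :: nat
    by auto
  show ?thesis
    unfolding te_structure_def shift_te_simps(1,2) index
    using closed by (auto simp: additive leibniz flat simp del: shift_te_simps)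
qed

lemma te_deformation_shift_te:
  assumes s: "s < r"
  shows "te_deformation (BF r) (shift_te r s) id"
proof -
  have pull: "germ_pull 1 (\<lambda>_. 0) (of_nat c * mvar 0) = of_nat c * mvar 0" for c
    by (rule mps_eqI) (auto simp: germ_pull_0 mcoeff_of_nat_mult mvar.rep_eq)
  have pull0: "germ_pull 1 (\<lambda>_. 0) 0 = 0"
    using pull[of 0] by simp
  have conn: "pull_conn (\<lambda>_. 0) (shift_te r s) 0 a b = (if a = b then of_nat (b + 1) * mvar 0 else 0)" for a b
    using pull[of "b + 1"] pull0
    by (auto simp: pull_conn_def unitvec_def tder_0 tder_1 simp del: of_nat_add of_nat_Suc One_nat_def)
  have "te_act (te_restrict (shift_te r s)) 0 v = te_act (BF r) 0 v" if v: "v \<in> freemod 0 (r + 1)" for v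
  proof
    fix b
    have "(\<Sum>a<r + 1. v a * pull_conn (\<lambda>_. 0) (shift_te r s) 0 a b) =
        (\<Sum>a<r + 1. if a = b then v b * (of_nat (b + 1) * mvar 0) else 0)"
      unfolding conn by (intro sum.cong) auto
    also have "\<dots> = v b * (of_nat (b + 1) * mvar 0)"
      using freemodD(2)[OF v, of b] by (simp add: sum.delta)
    finally show "te_act (te_restrict (shift_te r s)) 0 v b = te_act (BF r) 0 v b"
      by (simp add: te_restrict_def te_pull_def BF_def mult_ac)
  qed
  then have "te_iso (te_restrict (shift_te r s)) (BF r) id"
    by (auto simp: te_iso_def te_restrict_def te_pull_def BF_def)
  with te_structure_shift_te[OF s] show ?thesis
    by (simp add: te_deformation_def)
qed

section \<open>Comparison with a versal deformation\<close>

text \<open>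
  Pulling back along \<open>g\<close> replaces the Higgs field by its value on the tangent vector \<open>dg(\<partial>\<^sub>z\<^sub>1)\<close>, so
  the fibre at \<open>0\<close> of an isomorphism intertwines \<open>N\<close> with this value.  Compatibility with the given
  identifications of the restrictions forces that fibre map to be the one induced by \<open>\<tau>\<^sup>-\<^sup>1\<close>; hence
  it depends neither on \<open>s\<close> nor on \<open>g\<close> and \<open>\<phi>\<close>.
\<close>

lemma shift_te_intertwines:
  fixes \<tau> r
  defines "\<Phi> \<equiv> \<lambda>M a b. mcoeff (inv_into (freemod 0 (te_rank M)) \<tau> (unitvec a) b) {#}"
  assumes M: "te_deformation (BF r) M \<tau>" and s: "s < r"
    and g: "germ_map 1 (te_dim M) g"
    and iso: "deformation_iso (shift_te r s) id (te_pull 1 g M) \<tau> \<phi>"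
    and a: "a \<le> r"
  shows "(\<Sum>b<te_rank M. \<Phi> M a b * higgs_along M (\<lambda>i. mcoeff (pdiff 1 (g i)) {#}) b c) =
         (if a = s then \<Phi> M (Suc s) c else 0)"
proof -
  have \<phi>: "te_iso (shift_te r s) (te_pull 1 g M) \<phi>"
    using iso by (simp add: deformation_iso_def)
  have \<phi>_in: "\<phi> v \<in> freemod 1 (te_rank M)" if "v \<in> freemod 1 (r + 1)" for v
    using \<phi> that by (auto simp: te_iso_def te_pull_def dest!: bij_betwE)
  have fibre: "mcoeff (\<phi> (unitvec d) b) {#} = \<Phi> M d b" if d: "d \<le> r" for d b
  proof -
    define x where "x = (\<lambda>b. germ_pull 1 (\<lambda>_. 0) (\<phi> (unitvec d) b))"
    have "hom_restrict (shift_te r s) \<phi> (unitvec d) b = x b" for b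
    proof -
      have "hom_restrict (shift_te r s) \<phi> (unitvec d) b =
          (\<Sum>a<r + 1. if a = d then x b else 0)"
        unfolding hom_restrict_def hom_pull_def x_def by (intro sum.cong) (auto simp: unitvec_def)
      with d show ?thesis by (simp add: sum.delta)
    qed
    then have "\<tau> x = unitvec d"
      using iso unitvec_in_freemod[of d "r + 1" 0] d
      by (auto simp: deformation_iso_def te_restrict_def te_pull_def fun_eq_iff[symmetric] dest!: ext)
    moreover have "x \<in> freemod 0 (te_rank M)"
    proof -
      have "\<phi> (unitvec d) \<in> freemod 1 (te_rank M)"
        using d by (intro \<phi>_in unitvec_in_freemod) auto
      then show ?thesis
        using germs_restrict[of _ 1] by (auto simp: freemod_def x_def intro!: mps_eqI)
          (auto simp: germ_pull_0 zero_mps.rep_eq)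
    qed
    moreover have "inj_on \<tau> (freemod 0 (te_rank M))"
      using M by (auto simp: te_deformation_def te_iso_def te_restrict_def te_pull_def bij_betw_def)
    ultimately have "inv_into (freemod 0 (te_rank M)) \<tau> (unitvec d) = x"
      by (metis inv_into_f_f)
    then show ?thesis
      by (simp add: \<Phi>_def x_def germ_pull_0)
  qed
  have ea: "unitvec a \<in> freemod 1 (r + 1)"
    using a by (intro unitvec_in_freemod) auto
  define N where "N = te_act (shift_te r s) 1 (unitvec a)"
  have N: "N = (\<lambda>b. if a = s \<and> b = Suc s then 1 else 0)"
    by (auto simp: N_def fun_eq_iff unitvec_def tder_0 tder_1)
  have "mcoeff (te_act (te_pull 1 g M) 1 (\<phi> (unitvec a)) c) {#} =
      (\<Sum>b<te_rank M. \<Phi> M a b * higgs_along M (\<lambda>i. mcoeff (pdiff 1 (g i)) {#}) b c)"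
  proof -
    have "mcoeff (germ_pull (te_dim M) g f) {#} = mcoeff f {#}" for f
      using germ_map_pure[OF g] by (intro germ_pull_pure) auto
    then have "mcoeff (pull_conn g M 1 b c) {#} =
        higgs_along M (\<lambda>i. mcoeff (pdiff 1 (g i)) {#}) b c" for b
      by (simp add: pull_conn_def higgs_along_def higgs_def mcoeff_sum mcoeff_const_mult)
    then show ?thesis
      by (simp add: te_pull_def plus_mps.rep_eq mcoeff_sum mcoeff_const_mult mcoeff_const_tder fibre a)
  qed
  moreover have "te_act (te_pull 1 g M) 1 (\<phi> (unitvec a)) = \<phi> N"
    using \<phi> ea by (simp add: te_iso_def N_def)
  moreover have "mcoeff (\<phi> N c) {#} = (if a = s then \<Phi> M (Suc s) c else 0)"
  proof -
    have Nin: "N \<in> freemod 1 (r + 1)"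
      using s by (auto simp: N freemod_def germs_0 germs_1)
    have lin: "\<phi> (vadd u v) = vadd (\<phi> u) (\<phi> v)" "f \<in> germs 1 \<Longrightarrow> \<phi> (smul f u) = smul f (\<phi> u)"
      if "u \<in> freemod 1 (r + 1)" "v \<in> freemod 1 (r + 1)" for u v f
      using \<phi> that by (auto simp: te_iso_def)
    have "mcoeff (\<phi> N c) {#} = (\<Sum>b<r + 1. mcoeff (N b) {#} * mcoeff (\<phi> (unitvec b) c) {#})"
    proof (rule fibre_map[OF _ _ Nin])
      fix f d assume f: "f \<in> germs 1" and d: "d < r + 1"
      have "\<phi> (smul f (unitvec d)) = smul f (\<phi> (unitvec d))"
        using lin(2)[OF unitvec_in_freemod[OF d] unitvec_in_freemod[OF d] f] .
      then show "mcoeff (\<phi> (smul f (unitvec d)) c) {#} = mcoeff f {#} * mcoeff (\<phi> (unitvec d) c) {#}"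
        by (simp add: smul_def mcoeff_const_mult)
    qed (rule lin)
    also have "\<dots> = (\<Sum>b<r + 1. if b = Suc s then if a = s then \<Phi> M (Suc s) c else 0 else 0)"
      using s by (intro sum.cong) (auto simp: N fibre zero_mps.rep_eq one_mps.rep_eq)
    finally show ?thesis using s by (simp add: sum.delta)
  qed
  ultimately show ?thesis by simp
qed

text \<open>
  Otherwise a basis vector of \<open>\<B>\<^sup>F\<close> would be \<open>z\<^sub>0\<close> times the image of some \<open>y\<close>.
\<close>

lemma fibre_nonzero:
  assumes \<tau>: "te_iso (te_restrict M) (BF r) \<tau>" and a: "a \<le> r"
  shows "\<exists>c<te_rank M. mcoeff (inv_into (freemod 0 (te_rank M)) \<tau> (unitvec a) c) {#} \<noteq> 0"
proof (rule ccontr)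
  assume neg: "\<not> ?thesis"
  let ?F = "freemod 0 (te_rank M)"
  define x where "x = inv_into ?F \<tau> (unitvec a)"
  have x0: "mcoeff (x c) {#} = 0" if "c < te_rank M" for c
    using neg that by (auto simp: x_def)
  have bij: "bij_betw \<tau> ?F (freemod 0 (r + 1))"
    and lin: "\<And>f v. f \<in> germs 0 \<Longrightarrow> v \<in> ?F \<Longrightarrow> \<tau> (smul f v) = smul f (\<tau> v)"
    using \<tau> by (auto simp: te_iso_def te_restrict_def te_pull_def BF_def)
  have "unitvec a \<in> \<tau> ` ?F"
    using bij a by (simp add: bij_betw_def unitvec_in_freemod)
  then have x: "x \<in> ?F" "\<tau> x = unitvec a"
    unfolding x_def by (rule inv_into_into, rule f_inv_into_f)
  have "\<exists>h\<in>germs 0. x c = mvar 0 * h" if "c < te_rank M" for c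
    using germs_0_divide[OF freemodD(1)[OF x(1) that] x0[OF that]] .
  then obtain h where h: "\<And>c. c < te_rank M \<Longrightarrow> h c \<in> germs 0 \<and> x c = mvar 0 * h c"
    by metis
  define y where "y = (\<lambda>c. if c < te_rank M then h c else 0)"
  have y: "y \<in> ?F" "x = smul (mvar 0) y"
    using h freemodD(2)[OF x(1)] by (auto simp: y_def freemod_def smul_def fun_eq_iff)
  have "mvar 0 \<in> germs 0"
    using germs_mvar_mult[OF germs_1, of 0 0] by simp
  with x y lin have "unitvec a a = mvar 0 * \<tau> y a"
    by (metis smul_def)
  then have "mcoeff 1 {#} = mcoeff (mvar 0 * \<tau> y a) {#}"
    by (simp add: unitvec_def)
  then show False
    by (simp add: mcoeff_mvar_mult one_mps.rep_eq)
qed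

section \<open>Non-existence\<close>

theorem mainTheorem3:
  fixes r :: nat
  assumes "r \<ge> 2"
  shows "\<not> (\<exists>M \<tau>. versal_deformation (BF r) M \<tau> \<and> te_dim M = r + 1)"
proof
  assume "\<exists>M \<tau>. versal_deformation (BF r) M \<tau> \<and> te_dim M = r + 1"
  then obtain M \<tau> where def: "te_deformation (BF r) M \<tau>"
    and versal: "\<And>M' \<tau>'. te_deformation (BF r) M' \<tau>' \<Longrightarrow>
      \<exists>g \<phi>. germ_map (te_dim M') (te_dim M) g \<and>
        deformation_iso M' \<tau>' (te_pull (te_dim M') g M) \<tau> \<phi>"
    unfolding versal_deformation_def by blast
  define k where "k = te_rank M"
  define \<Phi> where "\<Phi> a b = mcoeff (inv_into (freemod 0 k) \<tau> (unitvec a) b) {#}" for a b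
  have row: "\<exists>X. \<forall>a\<le>r. \<forall>c<k. (\<Sum>b<k. \<Phi> a b * higgs_along M X b c) =
      (if a = s then \<Phi> (Suc s) c else 0)" if s: "s < r" for s
  proof -
    obtain g \<phi> where "germ_map 1 (te_dim M) g"
      "deformation_iso (shift_te r s) id (te_pull 1 g M) \<tau> \<phi>"
      using versal[OF te_deformation_shift_te[OF s]] by auto
    from shift_te_intertwines[OF def s this] show ?thesis
      unfolding \<Phi>_def k_def by blast
  qed
  obtain X where X: "\<And>a c. a \<le> r \<Longrightarrow> c < k \<Longrightarrow>
      (\<Sum>b<k. \<Phi> a b * higgs_along M X b c) = (if a = 0 then \<Phi> 1 c else 0)"
    using row[of 0] assms by (metis One_nat_def less_le_trans zero_less_numeral)
  obtain Y where Y: "\<And>a c. a \<le> r \<Longrightarrow> c < k \<Longrightarrow>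
      (\<Sum>b<k. \<Phi> a b * higgs_along M Y b c) = (if a = 1 then \<Phi> 2 c else 0)"
    using row[of 1] assms by (metis Suc_1 Suc_le_lessD One_nat_def)
  have M: "te_structure M" "te_iso (te_restrict M) (BF r) \<tau>"
    using def by (auto simp: te_deformation_def)
  have "\<Phi> 2 c = 0" if c: "c < k" for c
  proof -
    have assoc: "(\<Sum>b<k. (\<Sum>d<k. \<Phi> 0 d * higgs_along M V d b) * higgs_along M W b c) =
        (\<Sum>d<k. \<Phi> 0 d * (\<Sum>b<k. higgs_along M V d b * higgs_along M W b c))" for V W
      unfolding sum_distrib_left sum_distrib_right by (subst sum.swap) (simp add: mult_ac)
    have "\<Phi> 2 c = (\<Sum>b<k. \<Phi> 1 b * higgs_along M Y b c)"
      using Y[of 1 c] c assms by simp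
    also have "\<dots> = (\<Sum>b<k. (\<Sum>d<k. \<Phi> 0 d * higgs_along M X d b) * higgs_along M Y b c)"
      using X[of 0] by simp
    also have "\<dots> = (\<Sum>b<k. (\<Sum>d<k. \<Phi> 0 d * higgs_along M Y d b) * higgs_along M X b c)"
      unfolding assoc
      using higgs_along_commute[OF M(1), of _ X Y c] by (intro sum.cong) (auto simp: k_def)
    also have "\<dots> = 0"
      using Y[of 0] by simp
    finally show ?thesis .
  qed
  with fibre_nonzero[OF M(2), of 2] assms show False
    by (auto simp: \<Phi>_def k_def)
qed

end
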